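(* Let $X$ be a Hilbert space. Let $m \geq 2$, let $\chi_1,\ldots,\chi_m:(0,\infty)\to(0,\infty)$ and $\nu_2,\ldots,\nu_m:(0,\infty)\to(0,\infty)$ be functions, and let $R_1,\ldots,R_m:X \to X$ be super strongly nonexpansive mappings such that, for all $i\in\{1,\ldots,m\}$, $R_i$ has SSNE-modulus $\chi_i$, and, for all $i \in \{2,\ldots,m\}$, $R_i$ has supercoercivity modulus $\nu_i$. Put $R:=R_m \circ\ldots\circ R_1$. Let $K: (0,\infty) \to (0,\infty)$ be such that for all $i\in\{1,\ldots,m\}$ and all $\varepsilon > 0$ there is a $p \in X$ with $\|p\| \leq K(\varepsilon)$ and $\|p-R_ip\| \leq \varepsilon$. Then, for any $b>0$, $d>0$ and any $x \in X$ with $\|x\| \leq b$ and $\|x-Rx\|\leq d$, the function $\Sigma_{m,\{\chi_i\}_{i=1}^m,\{\nu_i\}_{i=2}^m,K,b,d}$ (defined in the context) is a rate of asymptotic regularity for the sequence $(R^nx)$ with respect to $R$, i.e., for any $\varepsilon>0$ and any $n\in\mathbb{N}$ with $n \geq \Sigma_{m,\{\chi_i\}_{i=1}^m,\{\nu_i\}_{i=2}^m,K,b,d}(\varepsilon)$, $$\|R^nx-R^{n+1}x\|\leq \varepsilon.$$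
   Context: Notions. Let $X$ be a Hilbert space and $T:X\to X$. $T$ is nonexpansive if $\|Tx-Ty\|\le\|x-y\|$ for all $x,y$. $T$ is super strongly nonexpansive if it is nonexpansive and, for all sequences $(x_n),(y_n)\subseteq X$ with $\lim_n(\|x_n-y_n\|^2-\|Tx_n-Ty_n\|^2)=0$, one has $\lim_n((x_n-y_n)-(Tx_n-Ty_n))=0$. A function $\chi:(0,\infty)\to(0,\infty)$ is an SSNE-modulus for $T$ if for every $\varepsilon>0$ and all $x,y\in X$ with $\|x-y\|^2-\|Tx-Ty\|^2<\chi(\varepsilon)$ one has $\|(x-y)-(Tx-Ty)\|<\varepsilon$. A function $\nu:(0,\infty)\to(0,\infty)$ is a supercoercivity modulus for a super strongly nonexpansive $T$ if for all $M>0$ and all $x,y\in X$ with $\|x-y\|^2-\|Tx-Ty\|^2<M\|(x-y)-(Tx-Ty)\|$ one has $\|(x-y)-(Tx-Ty)\|<\nu(M)$. Auxiliary functions. For $\chi,\psi,\alpha,\nu,\eta:(0,\infty)\to(0,\infty)$ and $\varepsilon,N,L_1,L_2,L_3>0$ put: $$\psi_\chi(\varepsilon):=\frac{\chi(2\varepsilon)}4,\qquad \alpha_\psi(\varepsilon):=\min\left(\psi(\varepsilon/2),\varepsilon^2/4\right),$$ $$\beta_\alpha(\varepsilon):=\min(\alpha(1)/4,\alpha(\varepsilon))\text{ if }\varepsilon<1,\qquad \beta_\alpha(\varepsilon):=\alpha(1)/4\text{ if }\varepsilon\ge1,$$ $$L_\psi(\varepsilon):=\max\left(\frac{4\varepsilon}{\sqrt{1+4\beta_{\alpha_\psi}(\varepsilon)}-1},2\varepsilon\right),\qquad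 \eta_\nu(N):=\nu(2N)/2,$$ $$\rho(\eta,L_1,L_2,L_3):=2L_3+L_1L_3+\eta(2L_1+2L_2+2),$$ $$\Theta(\eta,L_1,L_2,L_3):=(L_1+L_2)(L_3+\rho(\eta,L_1,L_2,L_3)).$$ For $\chi,\nu,K:(0,\infty)\to(0,\infty)$ and $\delta>0$ put: $$B(\nu,K,\delta):=\sqrt{\left(K\left(\tfrac\delta4\right)+\tfrac\delta8\right)^2+2\Theta\left(\eta_\nu,K\left(\tfrac\delta4\right)+\tfrac\delta8,K\left(\tfrac\delta4\right)+\tfrac\delta8,\tfrac\delta8\right)},$$ $$G(\nu,K,\delta):=B(\nu,K,\delta)\cdot\max\left(\sqrt2,\frac{4B(\nu,K,\delta)}\delta\right),$$ $$H(\chi,\nu,K,\delta):=L_{\psi_\chi}\left(G(\nu,K,\delta)+K\left(\tfrac\delta4\right)+\tfrac\delta8\right),$$ $$\Phi(\chi,\nu,K,\delta):=G(\nu,K,\delta)+H(\chi,\nu,K,\delta)+\tfrac\delta8.$$ For $n\ge1$ and $\chi_1,\ldots,\chi_n:(0,\infty)\to(0,\infty)$ put $\chi_{\chi_1,\ldots,\chi_n}(\varepsilon):=\min\{\chi_i(\varepsilon/n)\mid 1\le i\le n\}$. Define recursively $\Psi(2,\{\chi_i\}_{i=1}^1,\{\nu_i\}_{i=2}^2,K,\delta):=\Phi(\chi_1,\nu_2,K,\delta)$ and, for $m\ge2$, $\Psi(m+1,\{\chi_i\}_{i=1}^{m},\{\nu_i\}_{i=2}^{m+1},K,\delta):=\Phi(\chi_{\chi_1,\ldots,\chi_m},\nu_{m+1},K',\delta)$,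 where $K'(r):=\max(\Psi(m,\{\chi_i\}_{i=1}^{m-1},\{\nu_i\}_{i=2}^m,K,r),K(r))$ for $r>0$. For $\chi:(0,\infty)\to(0,\infty)$ put $\omega_\chi(b,\varepsilon):=\frac{\chi(\varepsilon)}{2b}$ for $b,\varepsilon>0$. For $\varepsilon,b,d>0$, $\alpha:(0,\infty)\to(0,\infty)$ and $\omega:(0,\infty)\times(0,\infty)\to(0,\infty)$ put $$\Gamma(\varepsilon,b,d,\alpha,\omega):=\left\lceil\frac{18b+12\alpha(\varepsilon/6)}\varepsilon-1\right\rceil\cdot\left\lceil\frac{d}{\omega\left(d,\frac{\varepsilon^2}{27b+18\alpha(\varepsilon/6)}\right)}\right\rceil.$$ Finally, for $m\ge2$, $$\Sigma_{m,\{\chi_i\}_{i=1}^m,\{\nu_i\}_{i=2}^m,K,b,d}(\varepsilon):=\Gamma\left(\varepsilon,b,d,\ \delta\mapsto\Psi(m,\{\chi_i\}_{i=1}^{m-1},\{\nu_i\}_{i=2}^m,K,\delta),\ \omega_{\chi_{\chi_1,\ldots,\chi_m}}\right).$$ *)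

theory Defs
  imports "HOL-Analysis.Analysis"
begin

text \<open>
  Functions from the positive reals to the positive reals are total functions of type
  \<open>real \<Rightarrow> real\<close> belonging to \<open>{0<..} \<rightarrow> {0<..}\<close>; their values at nonpositive arguments
  are irrelevant. Finite families such as \<open>chi\<^sub>1, \<dots>, chi\<^sub>m\<close> are functions on \<open>nat\<close> of which only
  the values at the indices in question matter.
\<close>

definition nonexpansive :: "('a::real_normed_vector \<Rightarrow> 'a) \<Rightarrow> bool" where
  "nonexpansive T \<longleftrightarrow> (\<forall>x y. norm (T x - T y) \<le> norm (x - y))"

definition super_strongly_nonexpansive :: "('a::real_normed_vector \<Rightarrow> 'a) \<Rightarrow> bool" where
  "super_strongly_nonexpansive T \<longleftrightarrow> nonexpansive T \<and>
     (\<forall>x y :: nat \<Rightarrow> 'a.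
        (\<lambda>n. (norm (x n - y n))\<^sup>2 - (norm (T (x n) - T (y n)))\<^sup>2) \<longlonglongrightarrow> 0 \<longrightarrow>
        (\<lambda>n. (x n - y n) - (T (x n) - T (y n))) \<longlonglongrightarrow> 0)"

definition ssne_modulus :: "(real \<Rightarrow> real) \<Rightarrow> ('a::real_normed_vector \<Rightarrow> 'a) \<Rightarrow> bool" where
  "ssne_modulus chi T \<longleftrightarrow> chi \<in> {0<..} \<rightarrow> {0<..} \<and>
     (\<forall>\<epsilon>>0. \<forall>x y. (norm (x - y))\<^sup>2 - (norm (T x - T y))\<^sup>2 < chi \<epsilon> \<longrightarrow>
        norm ((x - y) - (T x - T y)) < \<epsilon>)"

definition supercoercivity_modulus ::
    "(real \<Rightarrow> real) \<Rightarrow> ('a::real_normed_vector \<Rightarrow> 'a) \<Rightarrow> bool" where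
  "supercoercivity_modulus nu T \<longleftrightarrow> nu \<in> {0<..} \<rightarrow> {0<..} \<and>
     (\<forall>M>0. \<forall>x y.
        (norm (x - y))\<^sup>2 - (norm (T x - T y))\<^sup>2 < M * norm ((x - y) - (T x - T y)) \<longrightarrow>
        norm ((x - y) - (T x - T y)) < nu M)"

definition psi_of :: "(real \<Rightarrow> real) \<Rightarrow> real \<Rightarrow> real" where
  "psi_of chi \<epsilon> = chi (2 * \<epsilon>) / 4"

definition alpha_of :: "(real \<Rightarrow> real) \<Rightarrow> real \<Rightarrow> real" where
  "alpha_of \<psi> \<epsilon> = min (\<psi> (\<epsilon> / 2)) (\<epsilon>\<^sup>2 / 4)"

definition beta_of :: "(real \<Rightarrow> real) \<Rightarrow> real \<Rightarrow> real" where
  "beta_of \<alpha> \<epsilon> = (if \<epsilon> < 1 then min (\<alpha> 1 / 4) (\<alpha> \<epsilon>) else \<alpha> 1 / 4)"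

definition L_of :: "(real \<Rightarrow> real) \<Rightarrow> real \<Rightarrow> real" where
  "L_of \<psi> \<epsilon> = max (4 * \<epsilon> / (sqrt (1 + 4 * beta_of (alpha_of \<psi>) \<epsilon>) - 1)) (2 * \<epsilon>)"

definition eta_of :: "(real \<Rightarrow> real) \<Rightarrow> real \<Rightarrow> real" where
  "eta_of nu N = nu (2 * N) / 2"

definition rho_bound :: "(real \<Rightarrow> real) \<Rightarrow> real \<Rightarrow> real \<Rightarrow> real \<Rightarrow> real" where
  "rho_bound \<eta> L1 L2 L3 = 2 * L3 + L1 * L3 + \<eta> (2 * L1 + 2 * L2 + 2)"

definition Theta_bound :: "(real \<Rightarrow> real) \<Rightarrow> real \<Rightarrow> real \<Rightarrow> real \<Rightarrow> real" where
  "Theta_bound \<eta> L1 L2 L3 = (L1 + L2) * (L3 + rho_bound \<eta> L1 L2 L3)"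

definition B_bound :: "(real \<Rightarrow> real) \<Rightarrow> (real \<Rightarrow> real) \<Rightarrow> real \<Rightarrow> real" where
  "B_bound nu K \<delta> =
     sqrt ((K (\<delta> / 4) + \<delta> / 8)\<^sup>2 +
           2 * Theta_bound (eta_of nu) (K (\<delta> / 4) + \<delta> / 8) (K (\<delta> / 4) + \<delta> / 8) (\<delta> / 8))"

definition G_bound :: "(real \<Rightarrow> real) \<Rightarrow> (real \<Rightarrow> real) \<Rightarrow> real \<Rightarrow> real" where
  "G_bound nu K \<delta> = B_bound nu K \<delta> * max (sqrt 2) (4 * B_bound nu K \<delta> / \<delta>)"

definition H_bound ::
    "(real \<Rightarrow> real) \<Rightarrow> (real \<Rightarrow> real) \<Rightarrow> (real \<Rightarrow> real) \<Rightarrow> real \<Rightarrow> real" where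
  "H_bound chi nu K \<delta> = L_of (psi_of chi) (G_bound nu K \<delta> + K (\<delta> / 4) + \<delta> / 8)"

definition Phi_bound ::
    "(real \<Rightarrow> real) \<Rightarrow> (real \<Rightarrow> real) \<Rightarrow> (real \<Rightarrow> real) \<Rightarrow> real \<Rightarrow> real" where
  "Phi_bound chi nu K \<delta> = G_bound nu K \<delta> + H_bound chi nu K \<delta> + \<delta> / 8"

definition chi_comp :: "nat \<Rightarrow> (nat \<Rightarrow> real \<Rightarrow> real) \<Rightarrow> real \<Rightarrow> real" where
  "chi_comp n chi \<epsilon> = Min ((\<lambda>i. chi i (\<epsilon> / real n)) ` {1..n})"

text \<open>Only defined for \<open>m \<ge> 2\<close>; the values at \<open>m = 0\<close> and \<open>m = 1\<close> are unspecified.\<close>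

fun Psi_bound ::
    "nat \<Rightarrow> (nat \<Rightarrow> real \<Rightarrow> real) \<Rightarrow> (nat \<Rightarrow> real \<Rightarrow> real) \<Rightarrow> (real \<Rightarrow> real) \<Rightarrow> real \<Rightarrow> real" where
  "Psi_bound (Suc (Suc 0)) chi nu K \<delta> = Phi_bound (chi 1) (nu 2) K \<delta>"
| "Psi_bound (Suc (Suc (Suc k))) chi nu K \<delta> =
     Phi_bound (chi_comp (k + 2) chi) (nu (k + 3))
       (\<lambda>r. max (Psi_bound (Suc (Suc k)) chi nu K r) (K r)) \<delta>"

lemma Psi_bound_2: "Psi_bound 2 chi nu K \<delta> = Phi_bound (chi 1) (nu 2) K \<delta>"
  by (simp add: numeral_2_eq_2)

lemma Psi_bound_Suc:
  assumes "m \<ge> 2"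
  shows "Psi_bound (m + 1) chi nu K \<delta> =
    Phi_bound (chi_comp m chi) (nu (m + 1)) (\<lambda>r. max (Psi_bound m chi nu K r) (K r)) \<delta>"
proof -
  obtain k where "m = Suc (Suc k)"
    using assms by (metis add_2_eq_Suc le_Suc_ex)
  then show ?thesis
    by (simp add: eval_nat_numeral)
qed

definition omega_of :: "(real \<Rightarrow> real) \<Rightarrow> real \<Rightarrow> real \<Rightarrow> real" where
  "omega_of chi b \<epsilon> = chi \<epsilon> / (2 * b)"

definition Gamma_rate ::
    "real \<Rightarrow> real \<Rightarrow> real \<Rightarrow> (real \<Rightarrow> real) \<Rightarrow> (real \<Rightarrow> real \<Rightarrow> real) \<Rightarrow> int" where
  "Gamma_rate \<epsilon> b d \<alpha> \<omega> =
     \<lceil>(18 * b + 12 * \<alpha> (\<epsilon> / 6)) / \<epsilon> - 1\<rceil> *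
     \<lceil>d / \<omega> d (\<epsilon>\<^sup>2 / (27 * b + 18 * \<alpha> (\<epsilon> / 6)))\<rceil>"

definition Sigma_rate ::
    "nat \<Rightarrow> (nat \<Rightarrow> real \<Rightarrow> real) \<Rightarrow> (nat \<Rightarrow> real \<Rightarrow> real) \<Rightarrow> (real \<Rightarrow> real) \<Rightarrow>
     real \<Rightarrow> real \<Rightarrow> real \<Rightarrow> int" where
  "Sigma_rate m chi nu K b d \<epsilon> =
     Gamma_rate \<epsilon> b d (\<lambda>\<delta>. Psi_bound m chi nu K \<delta>) (omega_of (chi_comp m chi))"

text \<open>\<open>R\<^sub>m \<circ> \<dots> \<circ> R\<^sub>1\<close>, so that \<open>R\<^sub>1\<close> is applied first.\<close>

primrec comp_upto :: "nat \<Rightarrow> (nat \<Rightarrow> 'a \<Rightarrow> 'a) \<Rightarrow> 'a \<Rightarrow> 'a" where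
  "comp_upto 0 R = id"
| "comp_upto (Suc n) R = R (Suc n) \<circ> comp_upto n R"

end

theory Submission
  imports Defs
begin

text \<open>
  A nonexpansive map \<open>R\<close> is the reflected resolvent of the monotone operator whose graph consists
  of the pairs \<open>(a, a')\<close> with \<open>R (a + a') = a - a'\<close>. For two maps \<open>R\<close>, \<open>S\<close> with operators \<open>A\<close>,
  \<open>C\<close>, a pair in each with \<open>a\<close> close to \<open>c\<close> and \<open>a' + c'\<close> small gives the approximate fixed point
  \<open>a + a'\<close> of \<open>S \<circ> R\<close>. Such pairs come from a Brezis-Haraux argument: approximate fixed points of
  \<open>R\<close> and \<open>S\<close> give \<open>(b, b')\<close> and \<open>(e, e')\<close> with \<open>b'\<close>, \<open>e'\<close> small, and one solves
  \<open>\<kappa> a + a' + c' = b' + e'\<close> with \<open>C\<close> replaced by its Yosida regularization. Supercoercivity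
  of \<open>S\<close> bounds \<open>\<kappa> \<parallel>a\<parallel>\<^sup>2\<close> uniformly in the Yosida parameter, and the SSNE-modulus of \<open>R\<close>
  makes \<open>A\<close> bounded on bounded sets, so that \<open>c'\<close> stays bounded and \<open>a - c\<close> tends to 0. Induction
  yields bounded approximate fixed points of \<open>R\<^sub>m \<circ> \<dots> \<circ> R\<^sub>1\<close>, and a Bruck-Reich argument turns them
  into a rate of asymptotic regularity.
\<close>

section \<open>Reflected resolvents\<close>

text \<open>Polarization. When a map reflects both pairs, the left side is its defect between
  \<open>a + a'\<close> and \<open>b + b'\<close>. Conditions on the defect thus become conditions
  on the inner product that measures monotonicity.\<close>

lemma norm_sum_diff_gap:
  fixes a a' b b' :: "'a::real_inner"
  shows "(norm ((a + a') - (b + b')))\<^sup>2 - (norm ((a - a') - (b - b')))\<^sup>2 = 4 * ((a - b) \<bullet> (a' - b'))"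
  by (simp add: power2_norm_eq_inner inner_simps inner_commute algebra_simps)

lemma nonexpansive_graph_monotone:
  fixes R :: "'a::real_inner \<Rightarrow> 'a"
  assumes "nonexpansive R" and "R (a + a') = a - a'" and "R (b + b') = b - b'"
  shows "(a - b) \<bullet> (a' - b') \<ge> 0"
proof -
  have "norm ((a - a') - (b - b')) \<le> norm ((a + a') - (b + b'))"
    using assms unfolding nonexpansive_def by metis
  then have "(norm ((a - a') - (b - b')))\<^sup>2 \<le> (norm ((a + a') - (b + b')))\<^sup>2"
    by (intro power_mono) auto
  then show ?thesis using norm_sum_diff_gap[of a a' b b'] by linarith
qed

text \<open>In terms of \<open>p = a + a'\<close> the equation says that (1 + \<gamma>) p + (1 -
  \<gamma>) R p equals 2 z, that is \<open>f p = p\<close>. Here \<open>f\<close> is a contraction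
  because \<bar>1 - \<gamma>\<bar> < 1 + \<gamma>. This gives maximality of the operator by Banach's
  theorem.\<close>

lemma ex_resolvent_point:
  fixes R :: "'a::{real_inner, complete_space} \<Rightarrow> 'a"
  assumes "nonexpansive R" and "\<gamma> > 0"
  shows "\<exists>a a'. R (a + a') = a - a' \<and> a + \<gamma> *\<^sub>R a' = z"
proof -
  define f where "f p = (1 / (1 + \<gamma>)) *\<^sub>R (2 *\<^sub>R z - (1 - \<gamma>) *\<^sub>R R p)" for p
  define c where "c = \<bar>1 - \<gamma>\<bar> / (1 + \<gamma>)"
  have c: "0 \<le> c" "c < 1" using assms(2) by (auto simp: c_def)
  have "dist (f x) (f y) \<le> c * dist x y" for x y
  proof -
    have "f x - f y = (1 / (1 + \<gamma>)) *\<^sub>R ((1 - \<gamma>) *\<^sub>R (R y - R x))"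
      by (simp add: f_def scaleR_diff_right)
    then have "dist (f x) (f y) = c * norm (R x - R y)"
      using assms(2) by (simp add: dist_norm c_def norm_minus_commute)
    also have "\<dots> \<le> c * norm (x - y)"
      using assms(1) c by (intro mult_left_mono) (auto simp: nonexpansive_def)
    finally show ?thesis by (simp add: dist_norm)
  qed
  then have "\<exists>!p. f p = p"
    using c by (intro banach_fix_type) auto
  then obtain p where "f p = p" by auto
  then have "(1 + \<gamma>) *\<^sub>R p = (1 + \<gamma>) *\<^sub>R f p" by simp
  then have p: "(1 + \<gamma>) *\<^sub>R p + (1 - \<gamma>) *\<^sub>R R p = 2 *\<^sub>R z"
    using assms(2) by (simp add: f_def)
  define a where "a = (1 / 2) *\<^sub>R (p + R p)"
  define a' where "a' = (1 / 2) *\<^sub>R (p - R p)"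
  have "a + a' = p" "a - a' = R p"
    by (simp_all add: a_def a'_def algebra_simps flip: scaleR_add_left)
  moreover have "2 *\<^sub>R (a + \<gamma> *\<^sub>R a') = 2 *\<^sub>R z"
    unfolding p[symmetric] by (simp add: a_def a'_def algebra_simps)
  then have "a + \<gamma> *\<^sub>R a' = z" by simp
  ultimately show ?thesis by metis
qed

lemma resolvent_point_dist:
  fixes R :: "'a::real_inner \<Rightarrow> 'a"
  assumes "nonexpansive R" and "\<gamma> > 0"
    and "R (a + a') = a - a'" and "R (b + b') = b - b'"
  shows "norm (a - b) \<le> norm ((a + \<gamma> *\<^sub>R a') - (b + \<gamma> *\<^sub>R b'))"
proof -
  have "(norm (a - b))\<^sup>2 \<le> (norm (a - b))\<^sup>2 + \<gamma> * ((a - b) \<bullet> (a' - b'))"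
    using nonexpansive_graph_monotone[OF assms(1,3,4)] assms(2) by simp
  also have "\<dots> = (a - b) \<bullet> ((a + \<gamma> *\<^sub>R a') - (b + \<gamma> *\<^sub>R b'))"
    by (simp add: power2_norm_eq_inner inner_simps algebra_simps)
  also have "\<dots> \<le> norm (a - b) * norm ((a + \<gamma> *\<^sub>R a') - (b + \<gamma> *\<^sub>R b'))"
    by (rule norm_cauchy_schwarz)
  finally show ?thesis
    by (cases "norm (a - b) = 0") (auto simp: power2_eq_square)
qed

text \<open>\<open>J\<close> is the resolvent and \<open>J'\<close> the Yosida regularization, with
  parameter \<open>\<gamma>\<close>, of the operator attached to \<open>R\<close>.\<close>

lemma ex_resolvent:
  fixes R :: "'a::{real_inner, complete_space} \<Rightarrow> 'a"
  assumes "nonexpansive R" and "\<gamma> > 0"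
  obtains J J' where "\<And>z. R (J z + J' z) = J z - J' z" and "\<And>z. J z + \<gamma> *\<^sub>R J' z = z"
    and "nonexpansive J"
proof -
  obtain J J' where J: "R (J z + J' z) = J z - J' z" "J z + \<gamma> *\<^sub>R J' z = z" for z
    using ex_resolvent_point[OF assms] by metis
  moreover have "nonexpansive J"
    unfolding nonexpansive_def using resolvent_point_dist[OF assms J(1) J(1)] J(2) by simp
  ultimately show ?thesis using that by blast
qed

text \<open>
  Forward-backward splitting, with a step size for which the forward step at the Yosida
  regularization of the second operator reduces to its resolvent.
\<close>

lemma ex_regularized_zero:
  fixes R S :: "'a::{real_inner, complete_space} \<Rightarrow> 'a"
  assumes "nonexpansive R" and "nonexpansive S" and "\<kappa> > 0" and "\<mu> > 0"
  obtains a a' c c' where "R (a + a') = a - a'" and "S (c + c') = c - c'"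
    and "\<kappa> *\<^sub>R a + a' + c' = w" and "c + \<mu> *\<^sub>R c' = a"
proof -
  define t where "t = 1 + \<mu> * \<kappa>"
  have t: "t > 1" using assms by (simp add: t_def)
  obtain J J' where J: "\<And>z. R (J z + J' z) = J z - J' z" "\<And>z. J z + (\<mu> / t) *\<^sub>R J' z = z"
    "nonexpansive J"
    using ex_resolvent[OF assms(1), of "\<mu> / t"] assms t by auto
  obtain I I' where I: "\<And>z. S (I z + I' z) = I z - I' z" "\<And>z. I z + \<mu> *\<^sub>R I' z = z"
    "nonexpansive I"
    using ex_resolvent[OF assms(2,4)] by auto
  \<comment> \<open>Multiplying the equation by \<open>\<mu>\<close> and inserting
    \<open>\<mu> *\<^sub>R I' a = a - I a\<close> gives
    \<open>t *\<^sub>R a + \<mu> *\<^sub>R a' = I a + \<mu> *\<^sub>R w\<close>. Dividing by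
    \<open>t\<close> turns this into \<open>a = f a\<close>.\<close>
  define f where "f a = J ((1 / t) *\<^sub>R (I a + \<mu> *\<^sub>R w))" for a
  have "dist (f x) (f y) \<le> (1 / t) * dist x y" for x y
  proof -
    have "norm (f x - f y) \<le> norm ((1 / t) *\<^sub>R (I x + \<mu> *\<^sub>R w) - (1 / t) *\<^sub>R (I y + \<mu> *\<^sub>R w))"
      using J(3) by (simp add: f_def nonexpansive_def)
    also have "\<dots> = (1 / t) * norm (I x - I y)"
      using t by (simp flip: scaleR_diff_right)
    also have "\<dots> \<le> (1 / t) * norm (x - y)"
      using I(3) t by (intro mult_left_mono) (auto simp: nonexpansive_def)
    finally show ?thesis by (simp add: dist_norm)
  qed
  then have "\<exists>!a. f a = a"
    using t by (intro banach_fix_type[of "1 / t"]) auto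
  then obtain a where a: "f a = a" by auto
  define z where "z = (1 / t) *\<^sub>R (I a + \<mu> *\<^sub>R w)"
  have Jz: "J z = a" using a by (simp add: f_def z_def)
  have "t *\<^sub>R (a + (\<mu> / t) *\<^sub>R J' z) = t *\<^sub>R z"
    using J(2)[of z] Jz by simp
  then have "t *\<^sub>R a + \<mu> *\<^sub>R J' z = I a + \<mu> *\<^sub>R w"
    using t by (simp add: z_def scaleR_add_right)
  moreover have "I a = a - \<mu> *\<^sub>R I' a" using I(2)[of a] by (simp add: algebra_simps)
  ultimately have "\<mu> *\<^sub>R (\<kappa> *\<^sub>R a + J' z + I' a) = \<mu> *\<^sub>R w"
    by (simp add: t_def algebra_simps)
  then have "\<kappa> *\<^sub>R a + J' z + I' a = w" using assms(4) by simp
  then show ?thesis using that[of a "J' z" "I a" "I' a"] J(1)[of z] Jz I(1,2)[of a] by simp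
qed

text \<open>
  Cut the segment from \<open>b + b'\<close> to \<open>a + a'\<close> into pieces of length between 1 and 2. If it is
  long, then \<open>R\<close> maps it almost onto its reflection, so on some piece the defect of
  \<open>R\<close> is below \<open>chi 1\<close> although the displacement is at least 1.
\<close>

lemma ssne_graph_growth:
  fixes R :: "'a::real_inner \<Rightarrow> 'a"
  assumes ne: "nonexpansive R" and chi: "ssne_modulus chi R"
    and a: "R (a + a') = a - a'" and b: "R (b + b') = b - b'"
    and ab: "norm (a - b) \<le> \<epsilon>" and "\<epsilon> > 0"
  shows "norm (a' - b') \<le> max 1 (max (2 * \<epsilon>) (16 * \<epsilon> / chi 1))"
proof (rule ccontr)
  define u where "u = (a + a') - (b + b')"
  define v where "v = (a - a') - (b - b')"
  define r where "r = norm u"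
  have chi1: "chi 1 > 0" using chi by (auto simp: ssne_modulus_def)
  have "norm v \<le> r"
    using ne a b unfolding nonexpansive_def u_def v_def r_def by metis
  moreover have "2 *\<^sub>R (a' - b') = u - v"
    by (simp add: u_def v_def algebra_simps scaleR_2)
  then have "2 * norm (a' - b') = norm (u - v)"
    by (metis abs_numeral norm_scaleR)
  ultimately have le_r: "norm (a' - b') \<le> r"
    using norm_triangle_ineq4[of u v] unfolding r_def by linarith
  assume "\<not> ?thesis"
  with le_r have r: "r > 1" "r > 2 * \<epsilon>" "r > 16 * \<epsilon> / chi 1" by auto
  define N where "N = nat \<lfloor>r\<rfloor>"
  define s where "s = r / real N"
  have N1: "N \<ge> 1" using r(1) by (simp add: N_def le_nat_iff)
  have N: "real N \<le> r" "r < real N + 1" using r(1) by (auto simp: N_def)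
  have s: "1 \<le> s" "s < 2" "s * real N = r" "s > 0"
    using N N1 by (auto simp: s_def field_simps)
  define x where "x i = (b + b') + (real i / real N) *\<^sub>R u" for i
  define g where "g i = R (x (Suc i)) - R (x i)" for i
  have "(\<Sum>i<N. g i) = R (x N) - R (x 0)"
    unfolding g_def by (rule sum_lessThan_telescope)
  also have "\<dots> = v"
    using N1 a b by (simp add: x_def u_def v_def)
  finally have "(\<Sum>i<N. g i \<bullet> - u) = v \<bullet> - u"
    by (metis inner_sum_left)
  \<comment> \<open>\<open>v\<close> differs from \<open>- u\<close> by
    \<open>2 *\<^sub>R (a - b)\<close>, whose norm is at most \<open>2 * \<epsilon>\<close>.\<close>
  moreover have "v \<bullet> - u \<ge> (s * (r - 2 * \<epsilon>)) * real N"
  proof -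
    have "v = 2 *\<^sub>R (a - b) - u" by (simp add: u_def v_def algebra_simps scaleR_2)
    then have "v \<bullet> - u = r\<^sup>2 - 2 * ((a - b) \<bullet> u)"
      by (simp add: r_def power2_norm_eq_inner inner_simps)
    moreover have "(a - b) \<bullet> u \<le> \<epsilon> * r"
      using norm_cauchy_schwarz[of "a - b" u] mult_right_mono[OF ab, of r]
      by (simp add: r_def)
    ultimately show ?thesis
      using s(3) by (simp add: power2_eq_square right_diff_distrib mult.commute mult.left_commute
          del: inner_minus_right)
  qed
  \<comment> \<open>Pigeonhole: among the \<open>N\<close> increments of \<open>R\<close> one does
    at least as well as the average.\<close>
  ultimately have "\<exists>i<N. g i \<bullet> - u \<ge> s * (r - 2 * \<epsilon>)"
    using sum_strict_mono[of "{..<N}" "\<lambda>i. g i \<bullet> - u" "\<lambda>i. s * (r - 2 * \<epsilon>)"] N1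
    by (force simp: not_le mult.commute)
  then obtain i where gi: "g i \<bullet> - u \<ge> s * (r - 2 * \<epsilon>)" by blast
  define h where "h = x (Suc i) - x i"
  have h: "h = (1 / real N) *\<^sub>R u"
    by (simp add: h_def x_def add_divide_distrib scaleR_add_left)
  have nh: "norm h = s" using N1 by (simp add: h s_def r_def)
  have "(norm h)\<^sup>2 - (norm (g i))\<^sup>2 < chi 1"
  proof -
    have "g i \<bullet> - u \<le> norm (g i) * r"
      using norm_cauchy_schwarz[of "g i" "- u"] by (simp add: r_def)
    then have "norm (g i) * r \<ge> s * (r - 2 * \<epsilon>)" using gi by linarith
    then have "norm (g i) \<ge> s * (r - 2 * \<epsilon>) / r" using r by (simp add: field_simps)
    also have "s * (r - 2 * \<epsilon>) / r = s * (1 - 2 * \<epsilon> / r)" using r by (simp add: field_simps)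
    finally have "(norm (g i))\<^sup>2 \<ge> (s * (1 - 2 * \<epsilon> / r))\<^sup>2"
      using r s assms(6) by (intro power_mono) auto
    also have "(s * (1 - 2 * \<epsilon> / r))\<^sup>2 = s\<^sup>2 * (1 - 4 * \<epsilon> / r) + s\<^sup>2 * (2 * \<epsilon> / r)\<^sup>2"
      by (simp add: power2_eq_square algebra_simps)
    finally have "(norm h)\<^sup>2 - (norm (g i))\<^sup>2 \<le> s\<^sup>2 * (4 * \<epsilon> / r)"
      by (simp add: nh algebra_simps) (smt (verit) zero_le_power2 mult_nonneg_nonneg)
    \<comment> \<open>The bound \<open>s < 2\<close> is where the constant 16 of the statement comes
      from.\<close>
    also have "\<dots> \<le> 2\<^sup>2 * (4 * \<epsilon> / r)"
      using s r assms(6) by (intro mult_right_mono power_mono) auto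
    also have "\<dots> < chi 1" using r chi1 by (simp add: field_simps)
    finally show ?thesis .
  qed
  \<comment> \<open>The contradiction: \<open>h\<close> is a positive multiple of \<open>u\<close>
    of length at least 1 and \<open>g i \<bullet> u \<le> 0\<close>, so projecting on
    \<open>u\<close> shows that \<open>h - g i\<close> has norm at least 1.\<close>
  then have "norm (h - g i) < 1"
    using chi unfolding ssne_modulus_def h_def g_def by (metis zero_less_one)
  then have "norm (h - g i) * r < 1 * r" using r by (intro mult_strict_right_mono) auto
  moreover have "(h - g i) \<bullet> u \<le> norm (h - g i) * r"
    using norm_cauchy_schwarz[of "h - g i" u] by (simp add: r_def)
  moreover have "(h - g i) \<bullet> u = s * r + g i \<bullet> - u"
    by (simp add: h inner_simps s_def r_def flip: power2_norm_eq_inner power2_eq_square)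
  moreover have "s * (r - 2 * \<epsilon>) \<ge> 0" using s r by auto
  moreover have "s * r \<ge> 1 * r" using s r by (intro mult_right_mono) auto
  ultimately show False using gi by linarith
qed

text \<open>Links the growth bound just proved to the \<open>L_of\<close> prescribed by the rate. As
  sqrt (1 + 4 \<beta>) is at most 1 + 2 \<beta>, \<open>L_of\<close> is at least
  \<open>2 * \<epsilon> / \<beta>\<close>, and \<open>beta_of\<close> is small enough for this to
  dominate both \<open>16 * \<epsilon> / chi 1\<close> and 1.\<close>

lemma growth_le_L_of:
  assumes chi: "chi \<in> {0<..} \<rightarrow> {0<..}" and e: "\<epsilon> > 0"
  shows "max 1 (max (2 * \<epsilon>) (16 * \<epsilon> / chi 1)) \<le> L_of (psi_of chi) \<epsilon>"
proof -
  define \<beta> where "\<beta> = beta_of (alpha_of (psi_of chi)) \<epsilon>"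
  have chi1: "chi 1 > 0" "chi \<epsilon> > 0" using chi e by auto
  have \<beta>: "\<beta> > 0" "\<beta> \<le> chi 1 / 16" "\<beta> \<le> 1 / 16" "\<epsilon> < 1 \<Longrightarrow> \<beta> \<le> \<epsilon>\<^sup>2 / 4"
    using chi1 e by (auto simp: \<beta>_def beta_of_def alpha_of_def psi_of_def)
  have "sqrt (1 + 4 * \<beta>) \<le> sqrt ((1 + 2 * \<beta>)\<^sup>2)"
    by (intro real_sqrt_le_mono) (simp add: power2_eq_square algebra_simps)
  then have "sqrt (1 + 4 * \<beta>) - 1 \<le> 2 * \<beta>" using \<beta>(1) by simp
  moreover have "sqrt (1 + 4 * \<beta>) - 1 > 0" using \<beta>(1) by simp
  ultimately have "4 * \<epsilon> / (2 * \<beta>) \<le> 4 * \<epsilon> / (sqrt (1 + 4 * \<beta>) - 1)"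
    using e \<beta>(1) by (intro divide_left_mono) auto
  then have L: "2 * \<epsilon> / \<beta> \<le> L_of (psi_of chi) \<epsilon>"
    by (simp add: L_of_def \<beta>_def)
  have "16 * \<epsilon> / chi 1 \<le> 2 * \<epsilon> / \<beta>"
    using \<beta>(1,2) e chi1 by (simp add: field_simps)
  moreover have "1 \<le> 2 * \<epsilon> / \<beta>"
  proof (cases "\<epsilon> < 1")
    case True
    then have "\<epsilon>\<^sup>2 \<le> \<epsilon>" using e by (simp add: power2_eq_square)
    then show ?thesis using \<beta>(1) \<beta>(4)[OF True] e by (simp add: field_simps)
  next
    case False
    then show ?thesis using \<beta>(1,3) by (simp add: field_simps)
  qed
  ultimately show ?thesis using L by (auto simp: L_of_def)
qed

section \<open>Approximate fixed points of compositions\<close>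

text \<open>Pair the equation with \<open>a - b\<close>. Monotonicity removes \<open>a' - b'\<close>
  and leaves \<open>- ((a - b) \<bullet> D)\<close>, which splits along
  \<open>a - b = (c - e) + \<mu> *\<^sub>R c' - (b - e)\<close>. Supercoercivity lets
  \<open>(c - e) \<bullet> D\<close> absorb \<open>(b - e) \<bullet> D\<close> up to a constant, so
  the bound is independent of \<open>\<mu>\<close>.\<close>

lemma regularized_zero_bound:
  fixes R S :: "'a::real_inner \<Rightarrow> 'a"
  assumes neR: "nonexpansive R" and neS: "nonexpansive S"
    and nu: "supercoercivity_modulus nu S"
    and a: "R (a + a') = a - a'" and b: "R (b + b') = b - b'"
    and c: "S (c + c') = c - c'" and e: "S (e + e') = e - e'"
    and \<kappa>: "\<kappa> > 0" and \<mu>: "0 < \<mu>" "\<mu> \<le> 1"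
    and zero: "\<kappa> *\<^sub>R a + a' + c' = b' + e'" and res: "c + \<mu> *\<^sub>R c' = a"
    and L: "norm b \<le> L" "norm e \<le> L" "norm e' \<le> l" "0 < l" "l \<le> L"
  shows "\<kappa> * (norm a)\<^sup>2 \<le> \<kappa> * L\<^sup>2 + 2 * Theta_bound (eta_of nu) L L l"
proof -
  define D where "D = c' - e'"
  \<comment> \<open>The argument at which \<open>rho_bound\<close> evaluates
    \<open>eta_of nu\<close> when both radii are \<open>L\<close>.\<close>
  define M where "M = 2 * L + 2 * L + 2"
  define \<eta> where "\<eta> = eta_of nu M"
  have L0: "L > 0" using L by linarith
  have M: "M > 0" "2 * L \<le> M" using L0 by (auto simp: M_def)
  have \<eta>: "\<eta> > 0" using nu M by (auto simp: \<eta>_def eta_of_def supercoercivity_modulus_def)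
  have mono: "(c - e) \<bullet> D \<ge> 0"
    using nonexpansive_graph_monotone[OF neS c e] by (simp add: D_def)
  \<comment> \<open>If the left side is positive, the defect
    \<open>4 * ((c - e) \<bullet> D)\<close> is below \<open>2 * M\<close> times the displacement
    \<open>2 * norm D\<close>. The modulus at \<open>2 * M\<close> then bounds
    \<open>2 * norm D\<close>; hence the doubling and halving in \<open>eta_of\<close>.\<close>
  have coercive: "2 * L * norm D - (c - e) \<bullet> D \<le> 2 * L * \<eta>"
  proof (cases "(c - e) \<bullet> D < 2 * L * norm D")
    case True
    have "(c + c' - (e + e')) - (c - c' - (e - e')) = 2 *\<^sub>R D"
      by (simp add: D_def algebra_simps scaleR_2)
    then have nD: "norm ((c + c' - (e + e')) - (S (c + c') - S (e + e'))) = 2 * norm D"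
      by (simp add: c e)
    have "2 * L * norm D \<le> M * norm D" using M by (intro mult_right_mono) auto
    with True have "4 * ((c - e) \<bullet> D) < 2 * M * (2 * norm D)" by linarith
    then have "(norm (c + c' - (e + e')))\<^sup>2 - (norm (S (c + c') - S (e + e')))\<^sup>2
        < 2 * M * norm ((c + c' - (e + e')) - (S (c + c') - S (e + e')))"
      unfolding nD using norm_sum_diff_gap[of c c' e e'] by (simp add: c e D_def)
    then have "2 * norm D < nu (2 * M)"
      using nu M nD unfolding supercoercivity_modulus_def
      by (metis zero_less_mult_iff zero_less_numeral)
    then have "2 * L * norm D \<le> 2 * L * \<eta>"
      using L0 by (intro mult_left_mono) (auto simp: \<eta>_def eta_of_def)
    then show ?thesis using mono by linarith
  next
    case False
    then show ?thesis using L0 \<eta> by (smt (verit) mult_nonneg_nonneg)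
  qed
  have "\<kappa> *\<^sub>R a = - (a' - b') - D"
    using zero unfolding D_def by (metis add_diff_cancel_left' add_diff_eq diff_add_eq_diff_diff_swap
      diff_diff_eq2 minus_diff_eq uminus_add_conv_diff add.commute)
  then have "\<kappa> * ((a - b) \<bullet> a) = (a - b) \<bullet> (- (a' - b') - D)"
    by (metis inner_scaleR_right)
  also have "\<dots> \<le> - ((a - b) \<bullet> D)"
    using nonexpansive_graph_monotone[OF neR a b] by (simp add: inner_diff_right)
  also have "\<dots> = - ((c - e) \<bullet> D) + \<mu> * - (c' \<bullet> D) + (b - e) \<bullet> D"
    by (simp add: inner_simps algebra_simps flip: res)
  finally have *: "\<kappa> * ((a - b) \<bullet> a) \<le> - ((c - e) \<bullet> D) + \<mu> * - (c' \<bullet> D) + (b - e) \<bullet> D" .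
  have "(b - e) \<bullet> D \<le> norm (b - e) * norm D" by (rule norm_cauchy_schwarz)
  also have "\<dots> \<le> 2 * L * norm D"
    using norm_triangle_ineq4[of b e] L by (intro mult_right_mono) auto
  finally have be: "(b - e) \<bullet> D \<le> 2 * L * norm D" .
  \<comment> \<open>Completing the square bounds \<open>- (c' \<bullet> D)\<close> without any bound
    on \<open>c'\<close>.\<close>
  have "0 \<le> (norm (c' - (1 / 2) *\<^sub>R e'))\<^sup>2" by simp
  also have "(norm (c' - (1 / 2) *\<^sub>R e'))\<^sup>2 = c' \<bullet> D + (norm e')\<^sup>2 / 4"
    by (simp add: D_def power2_norm_eq_inner inner_simps inner_commute)
  finally have "- (c' \<bullet> D) \<le> (norm e')\<^sup>2" using zero_le_power2[of "norm e'"] by linarith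
  then have "- (c' \<bullet> D) \<le> l\<^sup>2"
    using power_mono[OF L(3), of 2] by simp
  then have "\<mu> * - (c' \<bullet> D) \<le> \<mu> * l\<^sup>2" using \<mu> by (intro mult_left_mono) auto
  also have "\<dots> \<le> 1 * l\<^sup>2" using \<mu> by (intro mult_right_mono) auto
  finally have "\<kappa> * ((a - b) \<bullet> a) \<le> 2 * L * \<eta> + l\<^sup>2"
    using * be coercive by linarith
  moreover have "\<kappa> * (norm a)\<^sup>2 \<le> \<kappa> * (norm b)\<^sup>2 + 2 * (\<kappa> * ((a - b) \<bullet> a))"
  proof -
    have "0 \<le> (norm (a - b))\<^sup>2" by simp
    then have "(norm a)\<^sup>2 \<le> (norm b)\<^sup>2 + 2 * ((a - b) \<bullet> a)"
      by (simp add: power2_norm_eq_inner inner_simps inner_commute)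
    then have "\<kappa> * (norm a)\<^sup>2 \<le> \<kappa> * ((norm b)\<^sup>2 + 2 * ((a - b) \<bullet> a))"
      using \<kappa> by (intro mult_left_mono) auto
    then show ?thesis by (simp add: algebra_simps)
  qed
  moreover have "\<kappa> * (norm b)\<^sup>2 \<le> \<kappa> * L\<^sup>2"
    using \<kappa> L by (intro mult_left_mono power_mono) auto
  moreover have "2 * L * \<eta> + l\<^sup>2 \<le> Theta_bound (eta_of nu) L L l"
  proof -
    have "l * l \<le> L * l" using L by (intro mult_right_mono) auto
    moreover have "0 \<le> L * l" "0 \<le> L * (L * l)" using L L0 by auto
    moreover have "Theta_bound (eta_of nu) L L l = 2 * L * \<eta> + 6 * (L * l) + 2 * (L * (L * l))"
      by (simp add: Theta_bound_def rho_bound_def \<eta>_def M_def algebra_simps)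
    ultimately show ?thesis by (simp add: power2_eq_square)
  qed
  ultimately show ?thesis by linarith
qed

text \<open>First \<open>\<kappa>\<close> is chosen so that \<open>\<kappa> *\<^sub>R a\<close> is
  small, at the price of the radius \<open>G_bound\<close> for \<open>a\<close>. Growth of the first
  operator then bounds \<open>a'\<close>, hence \<open>c'\<close>, uniformly in
  \<open>\<mu>\<close>, and \<open>\<mu>\<close> is chosen last to bring \<open>a\<close> close to
  \<open>c\<close>.\<close>

lemma approx_fixpoint_comp:
  fixes R S :: "'a::{real_inner, complete_space} \<Rightarrow> 'a"
  assumes neR: "nonexpansive R" and neS: "nonexpansive S"
    and chi: "ssne_modulus chi R" and nu: "supercoercivity_modulus nu S"
    and "\<delta> > 0"
    and p: "norm p \<le> K (\<delta> / 4)" "norm (p - R p) \<le> \<delta> / 4"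
    and q: "norm q \<le> K (\<delta> / 4)" "norm (q - S q) \<le> \<delta> / 4"
  shows "\<exists>x. norm x \<le> Phi_bound chi nu K \<delta> \<and> norm (x - S (R x)) \<le> \<delta>"
proof -
  have split: "\<exists>b b'. T (b + b') = b - b' \<and> norm b \<le> K (\<delta> / 4) + \<delta> / 8 \<and> norm b' \<le> \<delta> / 8"
    if r: "norm r \<le> K (\<delta> / 4)" "norm (r - T r) \<le> \<delta> / 4" for T and r :: 'a
  proof (intro exI conjI)
    let ?b = "(1 / 2) *\<^sub>R (r + T r)" and ?b' = "(1 / 2) *\<^sub>R (r - T r)"
    have sum: "?b + ?b' = r" "?b - ?b' = T r"
      by (simp_all add: algebra_simps flip: scaleR_add_left)
    show "T (?b + ?b') = ?b - ?b'" unfolding sum ..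
    show b': "norm ?b' \<le> \<delta> / 8" using r(2) by simp
    have "?b = r - ?b'" using sum(1) by (metis add_diff_cancel_right')
    then show "norm ?b \<le> K (\<delta> / 4) + \<delta> / 8"
      using norm_triangle_ineq4[of r ?b'] r(1) b' by simp
  qed
  define L where "L = K (\<delta> / 4) + \<delta> / 8"
  define \<Theta> where "\<Theta> = Theta_bound (eta_of nu) L L (\<delta> / 8)"
  define B where "B = B_bound nu K \<delta>"
  define k where "k = max (sqrt 2) (4 * B / \<delta>)"
  obtain b b' where b: "R (b + b') = b - b'" "norm b \<le> L" "norm b' \<le> \<delta> / 8"
    using split[of p R, OF p] unfolding L_def by blast
  obtain e e' where e: "S (e + e') = e - e'" "norm e \<le> L" "norm e' \<le> \<delta> / 8"
    using split[of q S, OF q] unfolding L_def by blast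
  have "K (\<delta> / 4) \<ge> 0" using p(1) norm_ge_zero order_trans by blast
  then have L: "L \<ge> \<delta> / 8" "L > 0" using \<open>\<delta> > 0\<close> by (auto simp: L_def)
  have "eta_of nu (2 * L + 2 * L + 2) > 0"
    using L(2) nu by (auto simp: eta_of_def supercoercivity_modulus_def)
  then have "\<Theta> \<ge> 0"
    unfolding \<Theta>_def Theta_bound_def rho_bound_def using L(2) \<open>\<delta> > 0\<close>
    by (intro mult_nonneg_nonneg add_nonneg_nonneg) auto
  have B2: "B\<^sup>2 = L\<^sup>2 + 2 * \<Theta>"
    using \<open>\<Theta> \<ge> 0\<close> by (simp add: B_def B_bound_def L_def \<Theta>_def)
  have "B > 0"
    using L \<open>\<Theta> \<ge> 0\<close> by (simp add: B_def B_bound_def flip: L_def \<Theta>_def) (smt (verit) zero_less_power)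
  have k: "k > 0" "k\<^sup>2 \<ge> 2" "k * \<delta> \<ge> 4 * B"
  proof -
    have "k \<ge> sqrt 2" "k \<ge> 4 * B / \<delta>" by (auto simp: k_def)
    moreover from this(1) show "k > 0" by (smt (verit) real_sqrt_gt_zero)
    ultimately show "k\<^sup>2 \<ge> 2" "k * \<delta> \<ge> 4 * B"
      using power_mono[of "sqrt 2" k 2] \<open>\<delta> > 0\<close> by (auto simp: field_simps)
  qed
  have G: "G_bound nu K \<delta> = B * k" by (simp add: G_bound_def B_def k_def)
  \<comment> \<open>Since \<open>\<kappa> \<le> 1 / 2\<close>, the bound
    \<open>\<kappa> * L\<^sup>2 + 2 * \<Theta>\<close> is at most \<open>s\<^sup>2\<close>, and
    \<open>s\<close> is strictly below \<open>B\<close>. This strictness leaves the positive slack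
    \<open>\<tau>\<close>.\<close>
  define s where "s = sqrt (B\<^sup>2 - L\<^sup>2 / 2)"
  have "B\<^sup>2 - L\<^sup>2 / 2 \<ge> 0" using B2 \<open>\<Theta> \<ge> 0\<close> by simp
  then have s: "s \<ge> 0" "s\<^sup>2 = B\<^sup>2 - L\<^sup>2 / 2" by (simp_all add: s_def)
  have "s < B"
    by (rule power_less_imp_less_base[of _ 2]) (use s L \<open>B > 0\<close> in auto)
  define \<kappa> where "\<kappa> = 1 / k\<^sup>2"
  have \<kappa>: "\<kappa> > 0" "\<kappa> \<le> 1 / 2" using k by (auto simp: \<kappa>_def field_simps)
  \<comment> \<open>The errors add up to exactly \<open>\<delta>\<close>: twice
    \<open>\<delta> / 4 + s / k\<close> for \<open>a' + c'\<close> and twice \<open>\<tau>\<close>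
    for \<open>a - c\<close>.\<close>
  define \<tau> where "\<tau> = \<delta> / 4 - s / k"
  have \<tau>: "\<tau> > 0"
  proof -
    have "4 * s < k * \<delta>" using k(3) \<open>s < B\<close> by linarith
    then show ?thesis using k(1) by (simp add: \<tau>_def field_simps)
  qed
  define g where "g = G_bound nu K \<delta> + K (\<delta> / 4) + \<delta> / 8"
  have "B * k > 0" using \<open>B > 0\<close> k by simp
  then have "g > 0" using L by (simp add: g_def G L_def)
  define H where "H = L_of (psi_of chi) g"
  have H: "max 1 (max (2 * g) (16 * g / chi 1)) \<le> H"
    unfolding H_def using chi \<open>g > 0\<close> by (intro growth_le_L_of) (auto simp: ssne_modulus_def)
  \<comment> \<open>A bound for \<open>c'\<close>, with one summand each for \<open>b' + e'\<close>,
    \<open>\<kappa> *\<^sub>R a\<close> and \<open>a'\<close>; none of them involves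
    \<open>\<mu>\<close>.\<close>
  define C where "C = \<delta> / 4 + \<kappa> * (B * k) + (H + \<delta> / 8)"
  have "C > 0" using H \<open>B * k > 0\<close> \<kappa> \<open>\<delta> > 0\<close> by (simp add: C_def add_pos_pos)
  define \<mu> where "\<mu> = min 1 (\<tau> / C)"
  have \<mu>: "0 < \<mu>" "\<mu> \<le> 1" "\<mu> * C \<le> \<tau>"
    using \<tau> \<open>C > 0\<close> by (auto simp: \<mu>_def min_def field_simps)
  obtain a a' c c' where a: "R (a + a') = a - a'" and c: "S (c + c') = c - c'"
    and zero: "\<kappa> *\<^sub>R a + a' + c' = b' + e'" and res: "c + \<mu> *\<^sub>R c' = a"
    using ex_regularized_zero[OF neR neS \<kappa>(1) \<mu>(1)] .
  have "\<kappa> * (norm a)\<^sup>2 \<le> \<kappa> * L\<^sup>2 + 2 * \<Theta>"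
    unfolding \<Theta>_def
    using regularized_zero_bound[OF neR neS nu a b(1) c e(1) \<kappa>(1) \<mu>(1,2) zero res b(2) e(2,3)]
      L \<open>\<delta> > 0\<close> by simp
  also have "\<dots> \<le> s\<^sup>2"
    using mult_right_mono[OF \<kappa>(2), of "L\<^sup>2"] by (simp add: s B2)
  finally have "(norm a)\<^sup>2 \<le> (s * k)\<^sup>2"
    using k by (simp add: \<kappa>_def field_simps power_mult_distrib)
  then have a_sk: "norm a \<le> s * k"
    by (rule power2_le_imp_le) (use s(1) k(1) in simp)
  have "\<kappa> * norm a \<le> \<kappa> * (s * k)"
    using a_sk \<kappa>(1) by (intro mult_left_mono) auto
  also have "\<dots> = s / k" using k(1) by (simp add: \<kappa>_def power2_eq_square)
  finally have \<kappa>a: "\<kappa> * norm a \<le> s / k" .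
  have "s * k \<le> B * k" using \<open>s < B\<close> k(1) by simp
  with a_sk have aG: "norm a \<le> B * k" by linarith
  have "norm (a - b) \<le> g"
    using norm_triangle_ineq4[of a b] aG b(2) by (simp add: g_def G L_def)
  then have "norm (a' - b') \<le> H"
    using ssne_graph_growth[OF neR chi a b(1) _ \<open>g > 0\<close>] H by linarith
  then have a'H: "norm a' \<le> H + \<delta> / 8"
    using norm_triangle_ineq[of "a' - b'" b'] b(3) by simp
  have be: "norm (b' + e') \<le> \<delta> / 4" using norm_triangle_ineq[of b' e'] b(3) e(3) by linarith
  have ac': "a' + c' = (b' + e') - \<kappa> *\<^sub>R a"
    using zero by (simp add: algebra_simps)
  have "norm (a' + c') \<le> \<delta> / 4 + s / k"
    using norm_triangle_ineq4[of "b' + e'" "\<kappa> *\<^sub>R a"] be \<kappa>a \<kappa> by (simp add: ac')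
  moreover have "norm (a - c) \<le> \<tau>"
  proof -
    have "c' = (b' + e') - \<kappa> *\<^sub>R a - a'" using ac' by (simp add: algebra_simps)
    then have "norm c' \<le> norm (b' + e') + \<kappa> * norm a + norm a'"
      using norm_triangle_ineq4[of "(b' + e') - \<kappa> *\<^sub>R a" a'] norm_triangle_ineq4[of "b' + e'" "\<kappa> *\<^sub>R a"] \<kappa>
      by simp
    also have "\<dots> \<le> C"
      unfolding C_def using be a'H mult_left_mono[OF aG, of \<kappa>] \<kappa> by linarith
    finally have "\<mu> * norm c' \<le> \<mu> * C" using \<mu> by (intro mult_left_mono) auto
    with \<mu>(3) have "\<mu> * norm c' \<le> \<tau>" by linarith
    moreover have "a - c = \<mu> *\<^sub>R c'" by (simp flip: res)
    ultimately show ?thesis using \<mu>(1) by simp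
  qed
  \<comment> \<open>\<open>R\<close> sends \<open>a + a'\<close> to \<open>a - a'\<close>, which is
    close to \<open>c + c'\<close>; \<open>S\<close> sends the latter to \<open>c - c'\<close>,
    which is close to \<open>a + a'\<close>. Both distances are at most
    \<open>norm (a' + c') + norm (a - c)\<close>.\<close>
  moreover have "norm (a + a' - S (R (a + a'))) \<le> 2 * norm (a' + c') + 2 * norm (a - c)"
  proof -
    have "norm (S (c + c') - S (a - a')) \<le> norm ((c + c') - (a - a'))"
      using neS by (simp add: nonexpansive_def)
    also have "(c + c') - (a - a') = (a' + c') - (a - c)" by simp
    also have "norm \<dots> \<le> norm (a' + c') + norm (a - c)" by (rule norm_triangle_ineq4)
    finally have le: "norm (S (c + c') - S (a - a')) \<le> norm (a' + c') + norm (a - c)" .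
    have eq: "a + a' - S (R (a + a')) = ((a' + c') + (a - c)) + (S (c + c') - S (a - a'))"
      by (simp add: a c)
    show ?thesis
      unfolding eq using le norm_triangle_ineq[of "(a' + c') + (a - c)" "S (c + c') - S (a - a')"]
        norm_triangle_ineq[of "a' + c'" "a - c"] by linarith
  qed
  ultimately have "norm (a + a' - S (R (a + a'))) \<le> \<delta>" by (simp add: \<tau>_def)
  moreover have "H_bound chi nu K \<delta> = H" by (simp add: H_bound_def H_def g_def)
  then have "norm (a + a') \<le> Phi_bound chi nu K \<delta>"
    using norm_triangle_ineq[of a a'] aG a'H by (simp add: Phi_bound_def G)
  ultimately show ?thesis by blast
qed

section \<open>Compositions of finitely many maps\<close>

lemma nonexpansive_comp_upto:
  assumes "\<forall>i\<in>{1..m}. nonexpansive (R i)"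
  shows "nonexpansive (comp_upto m R)"
  using assms
proof (induction m)
  case (Suc m)
  then have "nonexpansive (comp_upto m R)" "nonexpansive (R (Suc m))" by auto
  then show ?case unfolding nonexpansive_def by (simp, meson order_trans)
qed (simp add: nonexpansive_def)

text \<open>The defect of a composition is the sum of the nonnegative defects of its factors, so
  each factor's defect is below the total. Each factor then contributes a displacement below
  \<open>\<epsilon>\<close>, and displacements add up.\<close>

lemma comp_upto_displacement:
  fixes R :: "nat \<Rightarrow> 'a::real_normed_vector \<Rightarrow> 'a"
  assumes "m \<ge> 1" and "\<epsilon> > 0"
    and "\<forall>i\<in>{1..m}. nonexpansive (R i)" and "\<forall>i\<in>{1..m}. ssne_modulus (chi i) (R i)"
    and "\<forall>i\<in>{1..m}. (norm (x - y))\<^sup>2 - (norm (comp_upto m R x - comp_upto m R y))\<^sup>2 < chi i \<epsilon>"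
  shows "norm ((x - y) - (comp_upto m R x - comp_upto m R y)) < real m * \<epsilon>"
  using assms
proof (induction m rule: nat_induct_at_least)
  case base
  then show ?case by (simp add: ssne_modulus_def)
next
  case (Suc m)
  let ?u = "comp_upto m R x" and ?v = "comp_upto m R y"
  let ?Ru = "R (Suc m) ?u" and ?Rv = "R (Suc m) ?v"
  have "nonexpansive (comp_upto m R)" "nonexpansive (R (Suc m))"
    using Suc.prems(2) by (auto intro: nonexpansive_comp_upto)
  then have "norm (?u - ?v) \<le> norm (x - y)" "norm (?Ru - ?Rv) \<le> norm (?u - ?v)"
    by (simp_all add: nonexpansive_def)
  then have sq: "(norm (?u - ?v))\<^sup>2 \<le> (norm (x - y))\<^sup>2" "(norm (?Ru - ?Rv))\<^sup>2 \<le> (norm (?u - ?v))\<^sup>2"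
    by (simp_all add: power_mono)
  have gap: "(norm (x - y))\<^sup>2 - (norm (?Ru - ?Rv))\<^sup>2 < chi i \<epsilon>" if "i \<in> {1..Suc m}" for i
    using Suc.prems(4) that by simp
  have "norm ((x - y) - (?u - ?v)) < real m * \<epsilon>"
  proof (rule Suc.IH)
    show "\<forall>i\<in>{1..m}. (norm (x - y))\<^sup>2 - (norm (?u - ?v))\<^sup>2 < chi i \<epsilon>"
    proof
      fix i assume "i \<in> {1..m}"
      then have "i \<in> {1..Suc m}" by simp
      from gap[OF this] show "(norm (x - y))\<^sup>2 - (norm (?u - ?v))\<^sup>2 < chi i \<epsilon>"
        using sq by linarith
    qed
  qed (use Suc.prems in auto)
  moreover have "(norm (x - y))\<^sup>2 - (norm (?Ru - ?Rv))\<^sup>2 < chi (Suc m) \<epsilon>"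
    by (rule gap) simp
  then have "(norm (?u - ?v))\<^sup>2 - (norm (?Ru - ?Rv))\<^sup>2 < chi (Suc m) \<epsilon>"
    using sq by linarith
  then have "norm ((?u - ?v) - (?Ru - ?Rv)) < \<epsilon>"
    using Suc.prems(1,3) by (simp add: ssne_modulus_def)
  ultimately show ?case
    using norm_triangle_ineq[of "(x - y) - (?u - ?v)" "(?u - ?v) - (?Ru - ?Rv)"]
    by (simp add: algebra_simps)
qed

lemma ssne_modulus_comp_upto:
  fixes R :: "nat \<Rightarrow> 'a::real_normed_vector \<Rightarrow> 'a"
  assumes m: "m \<ge> 1"
    and ne: "\<forall>i\<in>{1..m}. nonexpansive (R i)" and chi: "\<forall>i\<in>{1..m}. ssne_modulus (chi i) (R i)"
  shows "ssne_modulus (chi_comp m chi) (comp_upto m R)"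
  unfolding ssne_modulus_def
proof (intro conjI allI impI)
  have nonempty: "(\<lambda>i. chi i (\<epsilon> / real m)) ` {1..m} \<noteq> {}" for \<epsilon> using m by simp
  show "chi_comp m chi \<in> {0<..} \<rightarrow> {0<..}"
    using chi m nonempty by (auto simp: chi_comp_def ssne_modulus_def Pi_iff)
  fix \<epsilon> :: real and x y :: 'a
  assume "\<epsilon> > 0"
    and "(norm (x - y))\<^sup>2 - (norm (comp_upto m R x - comp_upto m R y))\<^sup>2 < chi_comp m chi \<epsilon>"
  then have "norm ((x - y) - (comp_upto m R x - comp_upto m R y)) < real m * (\<epsilon> / real m)"
    using m nonempty by (intro comp_upto_displacement[OF m _ ne chi]) (auto simp: chi_comp_def)
  then show "norm ((x - y) - (comp_upto m R x - comp_upto m R y)) < \<epsilon>" using m by simp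
qed

text \<open>Induction that splits off the last map: the composition of the others acts as the inner
  map with modulus \<open>chi_comp\<close>, and only the last map has to be supercoercive. The
  maximum in the recursion of \<open>Psi_bound\<close> provides one radius for the approximate fixed
  points of both.\<close>

lemma approx_fixpoint_comp_upto:
  fixes R :: "nat \<Rightarrow> 'a::{real_inner, complete_space} \<Rightarrow> 'a"
  assumes "m \<ge> 2"
    and "\<forall>i\<in>{1..m}. nonexpansive (R i)"
    and "\<forall>i\<in>{1..m}. ssne_modulus (chi i) (R i)"
    and "\<forall>i\<in>{2..m}. supercoercivity_modulus (nu i) (R i)"
    and "\<forall>i\<in>{1..m}. \<forall>\<epsilon>>0. \<exists>p. norm p \<le> K \<epsilon> \<and> norm (p - R i p) \<le> \<epsilon>"
    and "\<delta> > 0"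
  shows "\<exists>p. norm p \<le> Psi_bound m chi nu K \<delta> \<and> norm (p - comp_upto m R p) \<le> \<delta>"
  using assms
proof (induction m arbitrary: \<delta> rule: nat_induct_at_least)
  case base
  have K: "\<exists>p. norm p \<le> K (\<delta> / 4) \<and> norm (p - R i p) \<le> \<delta> / 4" if "i \<in> {1..2}" for i
    using base.prems(4)[rule_format, OF that, of "\<delta> / 4"] \<open>\<delta> > 0\<close> by simp
  obtain p q where "norm p \<le> K (\<delta> / 4)" "norm (p - R 1 p) \<le> \<delta> / 4"
    "norm q \<le> K (\<delta> / 4)" "norm (q - R 2 q) \<le> \<delta> / 4"
    using K[of 1] K[of 2] by auto
  then have "\<exists>x. norm x \<le> Phi_bound (chi 1) (nu 2) K \<delta> \<and> norm (x - R 2 (R 1 x)) \<le> \<delta>"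
    using base.prems by (intro approx_fixpoint_comp[of "R 1" "R 2" _ _ \<delta> p K q]) auto
  then show ?case by (simp add: Psi_bound_2 numeral_2_eq_2)
next
  case (Suc m)
  let ?T = "comp_upto m R" and ?K = "\<lambda>r. max (Psi_bound m chi nu K r) (K r)"
  obtain p where p: "norm p \<le> Psi_bound m chi nu K (\<delta> / 4)" "norm (p - ?T p) \<le> \<delta> / 4"
    using Suc.IH[of "\<delta> / 4"] Suc.prems by auto
  obtain q where q: "norm q \<le> K (\<delta> / 4)" "norm (q - R (Suc m) q) \<le> \<delta> / 4"
    using Suc.prems(4)[rule_format, of "Suc m" "\<delta> / 4"] \<open>\<delta> > 0\<close> by auto
  have "\<exists>x. norm x \<le> Phi_bound (chi_comp m chi) (nu (Suc m)) ?K \<delta> \<and>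
      norm (x - R (Suc m) (?T x)) \<le> \<delta>"
    using Suc.prems Suc.hyps p q
    by (intro approx_fixpoint_comp[of ?T "R (Suc m)" _ _ \<delta> p ?K q])
      (auto intro!: nonexpansive_comp_upto ssne_modulus_comp_upto)
  then show ?case using Psi_bound_Suc[OF Suc.hyps, of chi nu K \<delta>] by simp
qed

section \<open>Asymptotic regularity\<close>

lemma nonexpansive_funpow:
  assumes "nonexpansive T"
  shows "nonexpansive (T ^^ n)"
proof (induction n)
  case (Suc n)
  with assms show ?case unfolding nonexpansive_def by (simp, meson order_trans)
qed (simp add: nonexpansive_def)

lemma displacement_funpow_le:
  assumes "nonexpansive T"
  shows "norm (p - (T ^^ n) p) \<le> real n * norm (p - T p)"
proof (induction n)
  case (Suc n)
  have "norm ((T ^^ n) p - (T ^^ n) (T p)) \<le> norm (p - T p)"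
    using nonexpansive_funpow[OF assms] by (simp add: nonexpansive_def)
  then show ?case
    using Suc norm_triangle_ineq[of "p - (T ^^ n) p" "(T ^^ n) p - (T ^^ n) (T p)"]
    by (simp add: funpow_swap1 algebra_simps)
qed simp

text \<open>Factor the difference of squares; the sum of the two norms is at most
  \<open>2 * b\<close>, the denominator in \<open>omega_of\<close>.\<close>

lemma omega_of_modulus:
  fixes T :: "'a::real_normed_vector \<Rightarrow> 'a"
  assumes chi: "ssne_modulus chi T" and "\<epsilon> > 0" and "b > 0"
    and ne: "norm (T x - T y) \<le> norm (x - y)" and b: "norm (x - y) \<le> b"
    and om: "norm (x - y) - norm (T x - T y) < omega_of chi b \<epsilon>"
  shows "norm ((x - y) - (T x - T y)) < \<epsilon>"
proof -
  have "(norm (x - y))\<^sup>2 - (norm (T x - T y))\<^sup>2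
      = (norm (x - y) + norm (T x - T y)) * (norm (x - y) - norm (T x - T y))"
    by (simp add: power2_eq_square algebra_simps)
  also have "\<dots> \<le> (2 * b) * (norm (x - y) - norm (T x - T y))"
    using ne b by (intro mult_right_mono) auto
  also have "\<dots> < (2 * b) * omega_of chi b \<epsilon>"
    using om \<open>b > 0\<close> by (intro mult_strict_left_mono) auto
  also have "\<dots> = chi \<epsilon>" using \<open>b > 0\<close> by (simp add: omega_of_def)
  finally show ?thesis using chi \<open>\<epsilon> > 0\<close> by (simp add: ssne_modulus_def)
qed

text \<open>If each of the \<open>N\<close> blocks of length \<open>l\<close> lowered
  \<open>f\<close> by at least \<open>w\<close>, the initial budget \<open>d\<close> would be used
  up.\<close>

lemma ex_block_small_decrease:
  fixes f :: "nat \<Rightarrow> real"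
  assumes "f 0 \<le> d" and "d \<le> real N * w"
  shows "f (l * N) \<le> 0 \<or> (\<exists>i<N. f (l * i) - f (l * Suc i) < w)"
proof (rule disjCI)
  assume no: "\<not> (\<exists>i<N. f (l * i) - f (l * Suc i) < w)"
  have "f (l * i) \<le> f 0 - real i * w" if "i \<le> N" for i
    using that
  proof (induction i)
    case (Suc i)
    then have "f (l * i) - f (l * Suc i) \<ge> w" "f (l * i) \<le> f 0 - real i * w"
      using no not_less Suc_le_lessD by (blast, simp)
    then show ?case by (simp add: algebra_simps)
  qed simp
  from this[of N] show "f (l * N) \<le> 0" using assms by simp
qed

text \<open>
  Over a block of \<open>l\<close> steps along which the displacement is nearly constant as a vector, the
  orbit moves by about \<open>l\<close> times that vector; but it stays close to the orbit of an
  approximate fixed point, so the vector is small.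
\<close>

lemma displacement_le_of_small_block:
  fixes T :: "'a::real_normed_vector \<Rightarrow> 'a"
  assumes ne: "nonexpansive T"
    and x: "norm x \<le> b" and p: "norm p \<le> A" "norm (p - T p) \<le> \<delta>"
    and u: "\<And>j. u j = (T ^^ (k + j)) x - (T ^^ Suc (k + j)) x"
    and small: "\<And>j. j < l \<Longrightarrow> norm (u j - u (Suc j)) \<le> e"
  shows "real (Suc l) * norm (u l) \<le> 2 * (b + A) + real (Suc l) * \<delta> + real (Suc l) * (real l * e / 2)"
proof -
  define y where "y = (T ^^ k) x"
  define r where "r = (T ^^ k) p"
  have drift: "norm (u (l - i) - u l) \<le> real i * e" if "i \<le> l" for i
    using that
  proof (induction i)
    case (Suc i)
    then have "Suc (l - Suc i) = l - i" "l - Suc i < l" by auto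
    then have "norm (u (l - Suc i) - u (l - i)) \<le> e" using small by metis
    with Suc show ?case
      using norm_triangle_ineq[of "u (l - Suc i) - u (l - i)" "u (l - i) - u l"]
      by (simp add: algebra_simps)
  qed simp
  have "(\<Sum>j<Suc l. u j) = y - (T ^^ Suc l) y"
  proof -
    have "(\<Sum>j<n. u j) = y - (T ^^ n) y" for n
      by (induction n) (simp_all add: u y_def funpow_add add.commute[of k])
    then show ?thesis .
  qed
  \<comment> \<open>Compare with \<open>r\<close>, which is moved by at most \<open>\<delta>\<close>
    as \<open>T ^^ k\<close> is nonexpansive. Replacing \<open>y\<close> by \<open>r\<close> costs
    \<open>b + A\<close> at each end of the block.\<close>
  moreover have "norm (y - (T ^^ Suc l) y) \<le> 2 * (b + A) + real (Suc l) * \<delta>"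
  proof -
    have xp: "norm (x - p) \<le> b + A" using norm_triangle_ineq4[of x p] x p by linarith
    then have yr: "norm (y - r) \<le> b + A"
      using nonexpansive_funpow[OF ne, of k] order_trans unfolding nonexpansive_def y_def r_def by blast
    have "norm ((T ^^ Suc l) r - (T ^^ Suc l) y) \<le> norm (r - y)"
      using nonexpansive_funpow[OF ne, of "Suc l"] unfolding nonexpansive_def by blast
    moreover have "norm (r - (T ^^ Suc l) r) \<le> real (Suc l) * \<delta>"
    proof -
      have "T r = (T ^^ k) (T p)" by (simp add: r_def funpow_swap1)
      then have "norm (r - T r) \<le> norm (p - T p)"
        using nonexpansive_funpow[OF ne, of k] by (simp add: r_def nonexpansive_def)
      then have "real (Suc l) * norm (r - T r) \<le> real (Suc l) * \<delta>"
        using p by (intro mult_left_mono) auto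
      then show ?thesis using displacement_funpow_le[OF ne, of r "Suc l"] by linarith
    qed
    moreover have "norm (y - (T ^^ Suc l) y) \<le> norm (y - r) + norm (r - (T ^^ Suc l) r)
        + norm ((T ^^ Suc l) r - (T ^^ Suc l) y)"
      using norm_triangle_ineq[of "y - r" "r - (T ^^ Suc l) y"]
        norm_triangle_ineq[of "r - (T ^^ Suc l) r" "(T ^^ Suc l) r - (T ^^ Suc l) y"]
      by (simp del: funpow.simps)
    ultimately show ?thesis using yr by (simp add: norm_minus_commute)
  qed
  \<comment> \<open>Drift is measured backwards from the last index \<open>l\<close>, so the errors
    \<open>real i * e\<close> sum to an arithmetic series.\<close>
  moreover have "norm ((\<Sum>j<Suc l. u j) - real (Suc l) *\<^sub>R u l) \<le> real (Suc l) * (real l * e / 2)"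
  proof -
    have "(\<Sum>j<Suc l. u j) - real (Suc l) *\<^sub>R u l = (\<Sum>j<Suc l. u j - u l)"
      by (simp only: sum_subtractf sum_constant_scaleR card_lessThan)
    also have "norm \<dots> \<le> (\<Sum>j<Suc l. norm (u j - u l))" by (rule norm_sum)
    also have "\<dots> = (\<Sum>i<Suc l. norm (u (l - i) - u l))"
      using sum.nat_diff_reindex[of "\<lambda>j. norm (u j - u l)" "Suc l"] by simp
    also have "\<dots> \<le> (\<Sum>i<Suc l. real i * e)"
      using drift by (intro sum_mono) auto
    also have "\<dots> = real (Suc l) * (real l * e / 2)"
      by (induction l) (simp_all add: field_simps)
    finally show ?thesis .
  qed
  ultimately show ?thesis
    using norm_triangle_ineq2[of "real (Suc l) *\<^sub>R u l" "\<Sum>j<Suc l. u j"]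
    by (simp add: norm_minus_commute)
qed

text \<open>Displacement norms decrease along the orbit, so one index up to \<open>l * N\<close>
  with displacement at most \<open>\<epsilon>\<close> suffices. Unless the displacement vanishes at
  \<open>l * N\<close>, some block of length \<open>l\<close> lowers its norm by less than
  \<open>w\<close>; there the modulus makes it nearly constant as a vector.\<close>

lemma Gamma_rate_asymptotic_regularity:
  fixes T :: "'a::real_normed_vector \<Rightarrow> 'a"
  assumes ne: "nonexpansive T" and chi: "ssne_modulus chi T"
    and approx: "\<exists>p. norm p \<le> \<alpha> (\<epsilon> / 6) \<and> norm (p - T p) \<le> \<epsilon> / 6"
    and "b > 0" and "d > 0" and x: "norm x \<le> b" and d: "norm (x - T x) \<le> d"
    and "\<epsilon> > 0" and n: "int n \<ge> Gamma_rate \<epsilon> b d \<alpha> (omega_of chi)"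
  shows "norm ((T ^^ n) x - (T ^^ Suc n) x) \<le> \<epsilon>"
proof -
  define A where "A = \<alpha> (\<epsilon> / 6)"
  obtain p where p: "norm p \<le> A" "norm (p - T p) \<le> \<epsilon> / 6" using approx by (auto simp: A_def)
  then have "A \<ge> 0" using norm_ge_zero order_trans by blast
  define c where "c = 18 * b + 12 * A"
  have c: "c > 0" using \<open>A \<ge> 0\<close> \<open>b > 0\<close> by (simp add: c_def)
  \<comment> \<open>Chosen so that, with \<open>l\<close> below \<open>c / \<epsilon>\<close>, the
    drift term \<open>real l * e / 2\<close> is at most \<open>\<epsilon> / 3\<close>.\<close>
  define e where "e = \<epsilon>\<^sup>2 / (27 * b + 18 * A)"
  have e: "e > 0" "e * c = 2 * \<epsilon>\<^sup>2 / 3"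
    using \<open>A \<ge> 0\<close> \<open>b > 0\<close> \<open>\<epsilon> > 0\<close> by (auto simp: e_def c_def field_simps add_pos_nonneg)
  define w where "w = omega_of chi d e"
  have w: "w > 0"
    using chi e(1) \<open>d > 0\<close> unfolding w_def omega_of_def ssne_modulus_def
    by (intro divide_pos_pos) auto
  define l where "l = nat \<lceil>c / \<epsilon> - 1\<rceil>"
  define N where "N = nat \<lceil>d / w\<rceil>"
  \<comment> \<open>As \<open>c / \<epsilon> - 1\<close> exceeds -1, its ceiling is nonnegative and
    \<open>nat\<close> changes nothing; \<open>l = 0\<close> can occur.\<close>
  have "c / \<epsilon> > 0" "d / w > 0" using c \<open>\<epsilon> > 0\<close> \<open>d > 0\<close> w by auto
  then have lN: "int l = \<lceil>c / \<epsilon> - 1\<rceil>" "int N = \<lceil>d / w\<rceil>"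
    unfolding l_def N_def by (subst int_nat_eq; simp)+
  have "int n \<ge> int l * int N"
    using n by (simp only: lN Gamma_rate_def c_def A_def w_def e_def)
  then have n: "l * N \<le> n" by (simp flip: of_nat_mult)
  have l: "real (Suc l) \<ge> c / \<epsilon>" "real l < c / \<epsilon>" using lN(1) by linarith+
  have "d / w \<le> real N" using lN(2) by linarith
  then have N: "d \<le> real N * w" using w by (simp add: field_simps)
  define u where "u j = (T ^^ j) x - (T ^^ Suc j) x" for j
  have step: "norm (u (Suc j)) \<le> norm (u j)" for j
    using ne by (simp add: u_def nonexpansive_def)
  have anti: "norm (u j) \<le> norm (u i)" if "i \<le> j" for i j
    using lift_Suc_antimono_le[of "\<lambda>j. norm (u j)", OF step that] .
  have ud: "norm (u j) \<le> d" for j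
    using anti[of 0 j] d by (simp add: u_def)
  have "norm (u (l * N)) \<le> \<epsilon> \<or> (\<exists>i<N. norm (u (l * Suc i)) \<le> \<epsilon>)"
  proof (cases "norm (u (l * N)) \<le> 0")
    case False
    then obtain i where i: "i < N" "norm (u (l * i)) - norm (u (l * Suc i)) < w"
      using ex_block_small_decrease[of "\<lambda>j. norm (u j)" d N w l] ud N by blast
    define k where "k = l * i"
    have "norm (u (k + j) - u (k + Suc j)) \<le> e" if "j < l" for j
    proof -
      \<comment> \<open>By monotonicity the drop over one step inside the block is at most the drop
        over the whole block.\<close>
      have "norm (u (k + j)) \<le> norm (u k)" "norm (u (k + l)) \<le> norm (u (k + Suc j))"
        using that by (auto intro!: anti)
      then have "norm (u (k + j)) - norm (u (k + Suc j)) < w"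
        using i(2) by (simp add: k_def add.commute)
      then have "norm (u (k + j) - u (k + Suc j)) < e"
        using omega_of_modulus[OF chi e(1) \<open>d > 0\<close>, of "(T ^^ (k + j)) x" "(T ^^ Suc (k + j)) x"]
          ud[of "k + j"] step[of "k + j"] by (simp add: u_def w_def)
      then show ?thesis by simp
    qed
    then have "real (Suc l) * norm (u (k + l))
        \<le> 2 * (b + A) + real (Suc l) * (\<epsilon> / 6) + real (Suc l) * (real l * e / 2)"
      by (intro displacement_le_of_small_block[OF ne x p]) (auto simp: u_def)
    also have "\<dots> \<le> real (Suc l) * (\<epsilon> / 6) + real (Suc l) * (\<epsilon> / 6) + real (Suc l) * (\<epsilon> / 3)"
    proof -
      have "real (Suc l) * \<epsilon> \<ge> c" using l(1) \<open>\<epsilon> > 0\<close> by (simp add: field_simps)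
      then have "2 * (b + A) \<le> real (Suc l) * (\<epsilon> / 6)" using \<open>b > 0\<close> by (simp add: c_def)
      moreover have "real l * e / 2 \<le> \<epsilon> / 3"
      proof -
        have "real l * e \<le> (c / \<epsilon>) * e" using l(2) e by (intro mult_right_mono) auto
        also have "\<dots> = 2 * \<epsilon> / 3"
          using e(2) \<open>\<epsilon> > 0\<close> by (simp add: field_simps power2_eq_square)
        finally show ?thesis by simp
      qed
      then have "real (Suc l) * (real l * e / 2) \<le> real (Suc l) * (\<epsilon> / 3)"
        by (intro mult_left_mono) auto
      ultimately show ?thesis by linarith
    qed
    also have "\<dots> \<le> real (Suc l) * \<epsilon>"
      using \<open>\<epsilon> > 0\<close> by (simp flip: distrib_left)
    finally have "norm (u (k + l)) \<le> \<epsilon>" by (simp del: of_nat_Suc)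
    then show ?thesis using i(1) by (auto simp: k_def add.commute)
  qed (use \<open>\<epsilon> > 0\<close> in auto)
  then obtain j where j: "j \<le> N" "norm (u (l * j)) \<le> \<epsilon>"
    by (metis Suc_leI le_refl)
  have "l * j \<le> n" using n mult_le_mono2[OF j(1), of l] by linarith
  from anti[OF this] j(2) show ?thesis by (simp add: u_def)
qed

theorem theorem4p9:
  fixes R :: "nat \<Rightarrow> 'a::{real_inner, complete_space} \<Rightarrow> 'a"
    and T :: "'a \<Rightarrow> 'a"
    and chi nu :: "nat \<Rightarrow> real \<Rightarrow> real"
    and K :: "real \<Rightarrow> real"
    and m n :: nat
    and b d \<epsilon> :: real
    and x :: 'a
  assumes "m \<ge> 2"
    and "\<forall>i\<in>{1..m}. chi i \<in> {0<..} \<rightarrow> {0<..}"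
    and "\<forall>i\<in>{2..m}. nu i \<in> {0<..} \<rightarrow> {0<..}"
    and "\<forall>i\<in>{1..m}. super_strongly_nonexpansive (R i)"
    and "\<forall>i\<in>{1..m}. ssne_modulus (chi i) (R i)"
    and "\<forall>i\<in>{2..m}. supercoercivity_modulus (nu i) (R i)"
    and "T = comp_upto m R"
    and "K \<in> {0<..} \<rightarrow> {0<..}"
    and "\<forall>i\<in>{1..m}. \<forall>\<epsilon>>0. \<exists>p. norm p \<le> K \<epsilon> \<and> norm (p - R i p) \<le> \<epsilon>"
    and "b > 0"
    and "d > 0"
    and "norm x \<le> b"
    and "norm (x - T x) \<le> d"
    and "\<epsilon> > 0"
    and "int n \<ge> Sigma_rate m chi nu K b d \<epsilon>"
  shows "norm ((T ^^ n) x - (T ^^ (n + 1)) x) \<le> \<epsilon>"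
proof -
  have ne: "\<forall>i\<in>{1..m}. nonexpansive (R i)"
    using assms(4) by (simp add: super_strongly_nonexpansive_def)
  have "nonexpansive T" unfolding assms(7) using ne by (rule nonexpansive_comp_upto)
  moreover have "ssne_modulus (chi_comp m chi) T"
    unfolding assms(7) using assms(1,5) ne by (intro ssne_modulus_comp_upto) auto
  moreover have "\<exists>p. norm p \<le> Psi_bound m chi nu K (\<epsilon> / 6) \<and> norm (p - T p) \<le> \<epsilon> / 6"
    unfolding assms(7)
    using \<open>\<epsilon> > 0\<close> by (intro approx_fixpoint_comp_upto[OF assms(1) ne assms(5,6,9)]) auto
  ultimately have "norm ((T ^^ n) x - (T ^^ Suc n) x) \<le> \<epsilon>"
    using assms(10-15) unfolding Sigma_rate_def by (intro Gamma_rate_asymptotic_regularity) auto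
  then show ?thesis by simp
qed

end
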